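(* Let $s,k\geq 2$ be integers with $s\geq 2k$, and let $c(k,s) = \frac{k!}{k^k (2s(1 + 2^{k}))^{2^k}}$. Let $\mathcal{F}$ be a $k$-graph on $[n]$. Then there exists a $k$-partite subgraph $\mathcal{F}'\subseteq \mathcal{F}$ with some $k$-partition $(X_1,\dots,X_k)$ such that: (1) $|\mathcal{F}'|\geq c(k,s)|\mathcal{F}|$; (2) for every $J\in \mathrm{MI}(\mathcal{F}')$ and every $F\in\mathcal{F}'$, the set $F_J$ is $s$-strong in $\mathcal{F}'$; (3) for every $F\in \mathcal{F}'$ and $J\in \mathrm{MI}(\mathcal{F}')$, $d_{\mathcal{F}'}(F_J)\geq \max\{s, \frac{1}{2k}\frac{|\mathcal{F}'|}{n^{|J|}}\}$.
   Context: A $k$-graph $\mathcal{F}$ is $k$-partite with $k$-partition $(X_1,\dots,X_k)$ (a partition of the vertex set) if every edge contains exactly one vertex of each $X_i$. For $J\subseteq[k]$ and an edge $F$, $F_J:=F\cap\bigcup_{i\in J}X_i$. For a set $D$ contained in an edge, its pattern is $\pi(D)=\{i\in[k]: D\cap X_i\neq\emptyset\}$. $\mathrm{MI}(\mathcal{F})=\{\pi(E\cap F): E,F\in\mathcal{F}, E\neq F\}$ (computed with respect to the partition). The link of $D$ in $\mathcal{F}$ is $\mathcal{L}_{\mathcal{F}}(D)=\{F\setminus D: F\in\mathcal{F}, D\subseteq F\}$ (the empty set may be a member), and $d_{\mathcal{F}}(D)=|\mathcal{L}_{\mathcal{F}}(D)|$. A nonempty hypergraph $\mathcal{L}$ is $s$-diverse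 if every vertex $v$ satisfies $d_{\mathcal{L}}(v)<|\mathcal{L}|/s$. A set $D$ is $s$-strong in $\mathcal{F}$ if $\mathcal{L}_{\mathcal{F}}(D)$ is $s$-diverse. *)

theory Defs
  imports Complex_Main "HOL-Library.Disjoint_Sets"
begin

text \<open>A hypergraph is identified with its set of edges; the vertex set is given separately.\<close>

definition kgraph_on :: "nat \<Rightarrow> 'a set \<Rightarrow> 'a set set \<Rightarrow> bool" where
  "kgraph_on k V \<F> \<longleftrightarrow> (\<forall>F\<in>\<F>. F \<subseteq> V \<and> card F = k)"

text \<open>Parts may be empty. This matters only for a \<open>k\<close>-graph without edges, since an edge of a
  \<open>k\<close>-partite \<open>k\<close>-graph meets every part.\<close>

definition is_kpartition :: "nat \<Rightarrow> 'a set \<Rightarrow> (nat \<Rightarrow> 'a set) \<Rightarrow> bool" where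
  "is_kpartition k V X \<longleftrightarrow> (\<Union>i\<in>{1..k}. X i) = V \<and> disjoint_family_on X {1..k}"

definition kpartite_with :: "nat \<Rightarrow> 'a set \<Rightarrow> 'a set set \<Rightarrow> (nat \<Rightarrow> 'a set) \<Rightarrow> bool" where
  "kpartite_with k V \<F> X \<longleftrightarrow>
     kgraph_on k V \<F> \<and> is_kpartition k V X \<and> (\<forall>F\<in>\<F>. \<forall>i\<in>{1..k}. card (F \<inter> X i) = 1)"

definition edge_proj :: "(nat \<Rightarrow> 'a set) \<Rightarrow> 'a set \<Rightarrow> nat set \<Rightarrow> 'a set" where
  "edge_proj X F J = F \<inter> (\<Union>i\<in>J. X i)"

definition pattern :: "nat \<Rightarrow> (nat \<Rightarrow> 'a set) \<Rightarrow> 'a set \<Rightarrow> nat set" where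
  "pattern k X D = {i \<in> {1..k}. D \<inter> X i \<noteq> {}}"

definition MI :: "nat \<Rightarrow> (nat \<Rightarrow> 'a set) \<Rightarrow> 'a set set \<Rightarrow> nat set set" where
  "MI k X \<F> = {pattern k X (E \<inter> F) | E F. E \<in> \<F> \<and> F \<in> \<F> \<and> E \<noteq> F}"

definition link :: "'a set set \<Rightarrow> 'a set \<Rightarrow> 'a set set" where
  "link \<F> D = {F - D | F. F \<in> \<F> \<and> D \<subseteq> F}"

definition deg :: "'a set set \<Rightarrow> 'a set \<Rightarrow> nat" where
  "deg \<F> D = card (link \<F> D)"

text \<open>Letting \<open>v\<close> range over the whole type is harmless: points lying in no edge have degree \<open>0\<close>,
  so for finite nonempty \<open>\<L>\<close> and \<open>s > 0\<close> they satisfy the inequality.\<close>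

definition diverse :: "nat \<Rightarrow> 'a set set \<Rightarrow> bool" where
  "diverse s \<L> \<longleftrightarrow> \<L> \<noteq> {} \<and> (\<forall>v. real (deg \<L> {v}) < real (card \<L>) / real s)"

definition strong :: "nat \<Rightarrow> 'a set set \<Rightarrow> 'a set \<Rightarrow> bool" where
  "strong s \<F> D \<longleftrightarrow> diverse s (link \<F> D)"

definition c_const :: "nat \<Rightarrow> nat \<Rightarrow> real" where
  "c_const k s = fact k / (real k ^ k * (2 * real s * (1 + 2 ^ k)) ^ (2 ^ k))"

end

theory Submission
  imports Defs "HOL-Library.FuncSet"
begin

text \<open>A random colouring gives a \<open>k\<close>-partite subgraph \<open>H\<close>. Deleting from \<open>H\<close> all edges through
  projections \<open>F\<^sub>J\<close> that are not \<open>s\<close>-strong or have low degree leaves a subgraph with the required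
  properties. Low degrees cost at most half of \<open>H\<close>. Hence either the remaining subgraph is large, or
  for some \<open>J\<close> many edges are deleted because of projections of pattern \<open>J\<close> that are not
  \<open>s\<close>-strong. In the second case a \<open>1/s\<close>-fraction of these edges forms a subgraph for which \<open>J\<close> is no
  longer an intersection pattern; we start again from there. As there are fewer than \<open>2\<^sup>k\<close> intersection
  patterns, this stops within \<open>2\<^sup>k\<close> rounds.\<close>

section \<open>Edges, projections and intersection patterns in a \<open>k\<close>-partite
  graph\<close>

lemma kpartite_with_subset:
  assumes "kpartite_with k V H X" and "H' \<subseteq> H"
  shows "kpartite_with k V H' X"
  using assms unfolding kpartite_with_def kgraph_on_def by blast

lemma kpartite_with_finite:
  assumes "kpartite_with k V H X" and "finite V"
  shows "finite H"
  using assms finite_subset[of H "Pow V"] unfolding kpartite_with_def kgraph_on_def by blast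

lemma kpartite_with_unique:
  assumes "kpartite_with k V H X" "E \<in> H" "i \<in> {1..k}" "u \<in> E \<inter> X i" "v \<in> E \<inter> X i"
  shows "u = v"
proof -
  have "card (E \<inter> X i) = 1" using assms unfolding kpartite_with_def by blast
  then show ?thesis using assms(4,5) by (metis card_1_singletonE singletonD)
qed

lemma kpartite_with_meets:
  assumes "kpartite_with k V H X" "E \<in> H" "i \<in> {1..k}"
  obtains u where "u \<in> E \<inter> X i"
proof -
  have "card (E \<inter> X i) = 1" using assms unfolding kpartite_with_def by blast
  then show ?thesis using that by (metis card_1_singletonE insertI1)
qed

lemma kpartite_with_part:
  assumes "kpartite_with k V H X" "E \<in> H" "v \<in> E"
  obtains i where "i \<in> {1..k}" "v \<in> X i"
  using assms unfolding kpartite_with_def kgraph_on_def is_kpartition_def by blast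

text \<open>Each projection has exactly one vertex in every part indexed by \<open>J\<close>, so
  containment leaves no room for a difference. Hence the edges of \<open>H\<close> containing a
  projection \<open>D\<close> of pattern \<open>J\<close> are exactly those projecting to
  \<open>D\<close>.\<close>

lemma edge_proj_eqI:
  assumes "kpartite_with k V H X" "E \<in> H" "F \<in> H" "J \<subseteq> {1..k}" "edge_proj X F J \<subseteq> E"
  shows "edge_proj X E J = edge_proj X F J"
proof
  show "edge_proj X F J \<subseteq> edge_proj X E J" using assms(5) unfolding edge_proj_def by blast
  show "edge_proj X E J \<subseteq> edge_proj X F J"
  proof
    fix x assume "x \<in> edge_proj X E J"
    then obtain i where i: "i \<in> J" "x \<in> E \<inter> X i" unfolding edge_proj_def by blast
    obtain y where y: "y \<in> F \<inter> X i" using kpartite_with_meets[OF assms(1,3)] i(1) assms(4) by blast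
    have "y \<in> edge_proj X F J" using y i(1) unfolding edge_proj_def by blast
    moreover have "x = y"
      using kpartite_with_unique[OF assms(1,2) _ i(2)] y i(1) assms(4,5) calculation by blast
    ultimately show "x \<in> edge_proj X F J" by simp
  qed
qed

text \<open>In each part indexed by \<open>J\<close> the two edges share a vertex, and neither has a
  second one there.\<close>

lemma edge_proj_eq_if_pattern:
  assumes "kpartite_with k V H X" "E \<in> H" "F \<in> H" "pattern k X (E \<inter> F) = J"
  shows "edge_proj X E J = edge_proj X F J"
proof (rule edge_proj_eqI[OF assms(1-3)])
  show J: "J \<subseteq> {1..k}" using assms(4) unfolding pattern_def by blast
  show "edge_proj X F J \<subseteq> E"
  proof
    fix x assume "x \<in> edge_proj X F J"
    then obtain i where i: "i \<in> J" "x \<in> F \<inter> X i" unfolding edge_proj_def by blast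
    then obtain y where "y \<in> E \<inter> F \<inter> X i" using assms(4) unfolding pattern_def by blast
    then show "x \<in> E" using kpartite_with_unique[OF assms(1,3) _ i(2)] i(1) J by blast
  qed
qed

lemma MI_mono: "H' \<subseteq> H \<Longrightarrow> MI k X H' \<subseteq> MI k X H"
  unfolding MI_def by blast

text \<open>Edges that agree in every part coincide. The strictness is used twice: it saves one
  round of the iteration, and it provides a vertex of \<open>F\<close> outside
  \<open>F\<^sub>J\<close>.\<close>

lemma MI_psubset:
  assumes "kpartite_with k V H X" "J \<in> MI k X H"
  shows "J \<subset> {1..k}"
proof -
  obtain E F where EF: "E \<in> H" "F \<in> H" "E \<noteq> F" "pattern k X (E \<inter> F) = J"
    using assms(2) unfolding MI_def by blast
  have full: "edge_proj X E {1..k} = E" if "E \<in> H" for E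
    using assms(1) that unfolding kpartite_with_def kgraph_on_def is_kpartition_def edge_proj_def
    by blast
  have "J \<noteq> {1..k}"
    using edge_proj_eq_if_pattern[OF assms(1) EF(1,2,4)] full EF(1-3) by auto
  then show ?thesis using EF(4) unfolding pattern_def by blast
qed

section \<open>Links, degrees and diversity in terms of edge counts\<close>

lemma link_eq_image: "link H D = (\<lambda>F. F - D) ` {F \<in> H. D \<subseteq> F}"
  unfolding link_def by blast

lemma inj_on_Diff_supersets: "inj_on (\<lambda>F. F - D) {F \<in> H. D \<subseteq> F}"
  by (auto simp: inj_on_def)

lemma deg_eq_card: "deg H D = card {F \<in> H. D \<subseteq> F}"
  unfolding deg_def link_eq_image by (rule card_image[OF inj_on_Diff_supersets])

lemma deg_link_singleton:
  assumes "v \<notin> D"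
  shows "deg (link H D) {v} = card {F \<in> H. insert v D \<subseteq> F}"
proof -
  have "{L \<in> link H D. {v} \<subseteq> L} = (\<lambda>F. F - D) ` {F \<in> H. insert v D \<subseteq> F}"
    using assms unfolding link_def by blast
  moreover have "inj_on (\<lambda>F. F - D) {F \<in> H. insert v D \<subseteq> F}"
    by (auto simp: inj_on_def)
  ultimately show ?thesis unfolding deg_eq_card by (simp add: card_image)
qed

lemma deg_link_singleton_in:
  assumes "v \<in> D"
  shows "deg (link H D) {v} = 0"
proof -
  have "{L \<in> link H D. {v} \<subseteq> L} = {}" using assms unfolding link_def by blast
  then show ?thesis unfolding deg_eq_card by (metis card.empty)
qed

text \<open>A failure of diversity is witnessed by a vertex of large degree in the link. The link is
  nonempty, so this degree is positive; members of the link avoid \<open>D\<close>, so the vertex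
  lies outside \<open>D\<close>.\<close>

lemma not_strong_obtains:
  assumes "finite H" "F \<in> H" "D \<subseteq> F" "s > 0" "\<not> strong s H D"
  obtains v where "v \<notin> D" "card {E \<in> H. D \<subseteq> E} \<le> s * card {E \<in> H. insert v D \<subseteq> E}"
proof -
  have "link H D \<noteq> {}" using assms(2,3) unfolding link_def by blast
  then obtain v where v: "real (deg H D) / real s \<le> real (deg (link H D) {v})"
    using assms(5) unfolding strong_def diverse_def deg_def by (auto simp: not_less)
  have pos: "deg H D > 0" unfolding deg_eq_card using assms(1-3) by (auto simp: card_gt_0_iff)
  have "v \<notin> D"
  proof
    assume "v \<in> D"
    then show False using v pos assms(4) by (simp add: deg_link_singleton_in divide_le_0_iff)
  qed
  moreover have "real (deg H D) \<le> real s * real (deg (link H D) {v})"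
    using v assms(4) by (simp add: field_simps)
  then have "deg H D \<le> s * deg (link H D) {v}" by (metis of_nat_le_iff of_nat_mult)
  ultimately show ?thesis using that deg_link_singleton[of v D H] deg_eq_card[of H D] by simp
qed

text \<open>A vertex of \<open>F\<close> outside \<open>D\<close> has degree at least 1 in the link,
  and diversity bounds that degree by a \<open>1/s\<close> fraction of the link. This yields the
  term \<open>s\<close> in the maximum.\<close>

lemma strong_deg_ge:
  assumes "finite H" "F \<in> H" "D \<subset> F" "s > 0" "strong s H D"
  shows "s \<le> deg H D"
proof -
  obtain v where v: "v \<in> F" "v \<notin> D" using assms(3) by blast
  have "F \<in> {E \<in> H. insert v D \<subseteq> E}" using v assms by blast
  moreover have "finite {E \<in> H. insert v D \<subseteq> E}" using assms(1) by simp
  ultimately have "card {E \<in> H. insert v D \<subseteq> E} \<noteq> 0" using card_0_eq by blast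
  then have "1 \<le> deg (link H D) {v}" unfolding deg_link_singleton[OF v(2)] by linarith
  moreover have "real (deg (link H D) {v}) < real (deg H D) / real s"
    using assms(5) unfolding strong_def diverse_def deg_def by blast
  ultimately have "1 < real (deg H D) / real s" by linarith
  then show ?thesis using assms(4) by (simp add: field_simps)
qed

section \<open>The deletion process\<close>

text \<open>The proof deletes, one at a time, all edges through a projection that is not \<open>s\<close>-strong or
  has too small a degree. If \<open>D\<close> of pattern \<open>J\<close> is deleted for not being \<open>s\<close>-strong, then a
  \<open>1/s\<close>-fraction of the deleted edges share a vertex outside \<open>D\<close>; these go to \<open>G J\<close>.\<close>

lemma cleaning:
  fixes t :: "nat set \<Rightarrow> real"
  assumes "finite V" "kpartite_with k V H X" "s > 0" "\<J> \<subseteq> Pow {1..k}" "\<And>J. t J \<ge> 0"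
  shows "\<exists>R G. R \<subseteq> H \<and> (\<forall>J\<in>\<J>. G J \<subseteq> H \<and> J \<notin> MI k X (G J)) \<and>
    (\<forall>F\<in>R. \<forall>J\<in>\<J>. strong s R (edge_proj X F J) \<and> t J \<le> real (deg R (edge_proj X F J))) \<and>
    real (card H) \<le> real (card R) + real s * (\<Sum>J\<in>\<J>. real (card (G J)))
      + (\<Sum>J\<in>\<J>. real (card ((\<lambda>F. edge_proj X F J) ` H)) * t J)"
  using kpartite_with_finite[OF assms(2,1)] assms(2)
proof (induction H rule: finite_psubset_induct)
  case (psubset H)
  note H = \<open>kpartite_with k V H X\<close> and fin = \<open>finite H\<close>
  let ?p = "\<lambda>J F. edge_proj X F J"
  have finJ: "finite \<J>" using assms(4) by (meson finite_Pow_iff finite_atLeastAtMost finite_subset)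
  show ?case
  proof (cases "\<forall>F\<in>H. \<forall>J\<in>\<J>. strong s H (?p J F) \<and> t J \<le> real (deg H (?p J F))")
    case True
    have "\<forall>J\<in>\<J>. {} \<subseteq> H \<and> J \<notin> MI k X {}" unfolding MI_def by blast
    moreover have "0 \<le> (\<Sum>J\<in>\<J>. real (card (?p J ` H)) * t J)"
      using assms(5) by (intro sum_nonneg mult_nonneg_nonneg) auto
    ultimately show ?thesis using True by (intro exI[of _ H] exI[of _ "\<lambda>_. {}"]) auto
  next
    case False
    then obtain F J where FJ: "F \<in> H" "J \<in> \<J>"
      and bad: "\<not> (strong s H (?p J F) \<and> t J \<le> real (deg H (?p J F)))" by blast
    define D where "D = ?p J F"
    \<comment> \<open>All edges through the bad projection go at once, so \<open>D\<close> is not a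
      projection of any remaining edge.\<close>
    define N where "N = {E \<in> H. D \<subseteq> E}"
    define H' where "H' = H - N"
    have J: "J \<subseteq> {1..k}" using FJ(2) assms(4) by blast
    have DF: "D \<subseteq> F" unfolding D_def edge_proj_def by blast
    have N: "F \<in> N" "N \<subseteq> H" using FJ(1) DF unfolding N_def by auto
    have H': "H' \<subset> H" using N unfolding H'_def by blast
    have "kpartite_with k V H' X" using kpartite_with_subset[OF H] H' by blast
    \<comment> \<open>The properties in \<open>good\<close> concern only the final \<open>R\<close>
      and carry over unchanged; what remains is to charge the loss of \<open>N\<close> to one of the
      two sums.\<close>
    from psubset.IH[OF H' this] obtain R G where
      R: "R \<subseteq> H'" and G: "\<And>J. J \<in> \<J> \<Longrightarrow> G J \<subseteq> H'" "\<And>J. J \<in> \<J> \<Longrightarrow> J \<notin> MI k X (G J)"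
      and good: "\<forall>F\<in>R. \<forall>J\<in>\<J>. strong s R (?p J F) \<and> t J \<le> real (deg R (?p J F))"
      and le: "real (card H') \<le> real (card R) + real s * (\<Sum>J\<in>\<J>. real (card (G J)))
        + (\<Sum>J\<in>\<J>. real (card (?p J ` H')) * t J)" by blast
    have cardH: "real (card H) = real (card H') + real (card N)"
      using N fin unfolding H'_def
      by (metis card_Diff_subset card_mono finite_subset le_add_diff_inverse2 of_nat_add)
    have mono: "real (card (?p I ` H')) * t I \<le> real (card (?p I ` H)) * t I" for I
      using fin H' assms(5) by (intro mult_right_mono of_nat_mono card_mono) auto
    show ?thesis
    proof (cases "strong s H D")
      case True
      then have low: "real (card N) \<le> t J" using bad unfolding D_def N_def deg_eq_card by auto
      \<comment> \<open>\<open>D\<close> disappears from the projections of pattern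
        \<open>J\<close>, so the threshold sum drops by at least \<open>t J\<close>, which pays for
        \<open>N\<close>.\<close>
      have "D \<notin> ?p J ` H'" unfolding H'_def N_def edge_proj_def by blast
      then have "card (?p J ` H') + 1 = card (insert D (?p J ` H'))"
        using fin H' by (simp add: finite_subset[of H' H])
      also have "\<dots> \<le> card (?p J ` H)"
        using fin H' FJ(1) unfolding D_def by (intro card_mono) auto
      finally have "(real (card (?p J ` H')) + 1) * t J \<le> real (card (?p J ` H)) * t J"
        using assms(5) by (intro mult_right_mono) linarith+
      then have "(\<Sum>I\<in>\<J>. real (card (?p I ` H')) * t I) + real (card N)
          \<le> (\<Sum>I\<in>\<J>. real (card (?p I ` H)) * t I)"
        using low mono
          sum_mono[of "\<J> - {J}" "\<lambda>I. real (card (?p I ` H')) * t I"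
            "\<lambda>I. real (card (?p I ` H)) * t I"]
        by (simp add: sum.remove[OF finJ FJ(2)] algebra_simps)
      then have "real (card H) \<le> real (card R) + real s * (\<Sum>J\<in>\<J>. real (card (G J)))
        + (\<Sum>J\<in>\<J>. real (card (?p J ` H)) * t J)"
        using le cardH by linarith
      then show ?thesis using R G good H' by (intro exI[of _ R] exI[of _ G]) blast
    next
      case False
      obtain v where v: "v \<notin> D" "card N \<le> s * card {E \<in> H. insert v D \<subseteq> E}"
        using not_strong_obtains[OF fin FJ(1) DF assms(3) False] unfolding N_def by blast
      define M where "M = {E \<in> H. insert v D \<subseteq> E}"
      define G' where "G' = G(J := G J \<union> M)"
      have MN: "M \<subseteq> N" "M \<subseteq> H" unfolding M_def N_def by auto
      \<comment> \<open>Two edges meeting in pattern \<open>J\<close> have the same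
        \<open>J\<close>-projection. It is \<open>D\<close> for edges in \<open>M\<close> and never
        \<open>D\<close> for edges in \<open>G J\<close>, which avoid \<open>N\<close>; so both lie
        in \<open>M\<close> and share \<open>v\<close>. Then the part of \<open>v\<close> is indexed
        by \<open>J\<close>, which puts \<open>v\<close> into \<open>D\<close>.\<close>
      have "J \<notin> MI k X (G J \<union> M)"
      proof
        assume "J \<in> MI k X (G J \<union> M)"
        then obtain E1 E2 where E: "E1 \<in> G J \<union> M" "E2 \<in> G J \<union> M" "E1 \<noteq> E2"
          "pattern k X (E1 \<inter> E2) = J" unfolding MI_def by blast
        have EH: "E1 \<in> H" "E2 \<in> H" using E G(1)[OF FJ(2)] H' MN by auto
        have eq: "?p J E1 = ?p J E2" by (rule edge_proj_eq_if_pattern[OF H EH E(4)])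
        have proj: "?p J E = D" if "E \<in> M" for E
          using edge_proj_eqI[OF H _ FJ(1) J] that unfolding D_def M_def by auto
        have "E \<notin> N" if "E \<in> G J" for E
          using that G(1)[OF FJ(2)] unfolding H'_def by auto
        moreover have "E \<in> N" if "E \<in> H" "?p J E = D" for E
          using that unfolding N_def edge_proj_def by blast
        ultimately have "E1 \<in> M \<longleftrightarrow> E2 \<in> M" using E(1,2) EH eq proj by (metis Un_iff)
        moreover have "\<not> (E1 \<in> G J \<and> E2 \<in> G J)"
          using E(3,4) G(2)[OF FJ(2)] unfolding MI_def by blast
        ultimately have M: "E1 \<in> M" "E2 \<in> M" using E(1,2) by auto
        then have ve: "v \<in> E1" "v \<in> E2" unfolding M_def by auto
        obtain i where i: "i \<in> {1..k}" "v \<in> X i" using kpartite_with_part[OF H EH(1) ve(1)] by blast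
        have "i \<in> J" using i ve E(4) unfolding pattern_def by blast
        then have "v \<in> ?p J E1" using i ve unfolding edge_proj_def by blast
        then show False using proj[OF M(1)] v(1) by simp
      qed
      then have G': "\<forall>I\<in>\<J>. G' I \<subseteq> H \<and> I \<notin> MI k X (G' I)"
        using G H' MN(2) unfolding G'_def by (metis Un_subset_iff fun_upd_apply psubset_imp_subset subset_trans)
      \<comment> \<open>Disjointness lets \<open>M\<close> count in full, so \<open>s\<close> times
        the increase of the sum pays for \<open>N\<close>.\<close>
      have "G J \<inter> M = {}" using G(1)[OF FJ(2)] MN unfolding H'_def by blast
      then have "card (G J \<union> M) = card (G J) + card M"
        using G(1)[OF FJ(2)] H' MN(2) fin
        by (meson card_Un_disjoint finite_subset psubset_imp_subset)
      then have sumG: "(\<Sum>I\<in>\<J>. real (card (G' I))) = (\<Sum>I\<in>\<J>. real (card (G I))) + real (card M)"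
        by (simp add: G'_def sum.remove[OF finJ FJ(2)])
      have "real (card N) \<le> real s * real (card M)"
        using v(2) unfolding M_def by (metis of_nat_le_iff of_nat_mult)
      then have "real (card H) \<le> real (card R) + real s * (\<Sum>J\<in>\<J>. real (card (G' J)))
        + (\<Sum>J\<in>\<J>. real (card (?p J ` H)) * t J)"
        using le cardH sum_mono[of \<J> "\<lambda>I. real (card (?p I ` H')) * t I", OF mono]
        unfolding sumG distrib_left by linarith
      then show ?thesis using R H' good G' by (intro exI[of _ R] exI[of _ G']) blast
    qed
  qed
qed

section \<open>Counting projections\<close>

text \<open>A projection is the image of a choice function picking one vertex from each part indexed
  by \<open>J\<close>.\<close>

lemma card_edge_proj_le:
  assumes "kpartite_with k V H X" "finite V" "J \<subseteq> {1..k}"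
  shows "card ((\<lambda>F. edge_proj X F J) ` H) \<le> (\<Prod>i\<in>J. card (X i))"
proof -
  have finJ: "finite J" using assms(3) finite_subset by blast
  have XV: "X i \<subseteq> V" if "i \<in> J" for i
    using assms(1,3) that unfolding kpartite_with_def is_kpartition_def by blast
  have "(\<lambda>F. edge_proj X F J) ` H \<subseteq> (\<lambda>f. f ` J) ` (\<Pi>\<^sub>E i\<in>J. X i)"
  proof clarify
    fix F assume F: "F \<in> H"
    have "\<forall>i\<in>J. \<exists>u. u \<in> F \<inter> X i" using kpartite_with_meets[OF assms(1) F] assms(3) by blast
    then obtain f where f: "\<And>i. i \<in> J \<Longrightarrow> f i \<in> F \<inter> X i" by metis
    have "edge_proj X F J = restrict f J ` J"
    proof
      show "restrict f J ` J \<subseteq> edge_proj X F J" using f unfolding edge_proj_def by auto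
      show "edge_proj X F J \<subseteq> restrict f J ` J"
      proof
        fix x assume "x \<in> edge_proj X F J"
        then obtain i where i: "i \<in> J" "x \<in> F \<inter> X i" unfolding edge_proj_def by blast
        then have "x = f i" using kpartite_with_unique[OF assms(1) F _ i(2) f[OF i(1)]] assms(3) by blast
        then show "x \<in> restrict f J ` J" using i by auto
      qed
    qed
    moreover have "restrict f J \<in> (\<Pi>\<^sub>E i\<in>J. X i)" using f by auto
    ultimately show "edge_proj X F J \<in> (\<lambda>f. f ` J) ` (\<Pi>\<^sub>E i\<in>J. X i)" by blast
  qed
  moreover have "finite (\<Pi>\<^sub>E i\<in>J. X i)"
    using finJ finite_subset[OF XV assms(2)] by (intro finite_PiE)
  ultimately have "card ((\<lambda>F. edge_proj X F J) ` H) \<le> card (\<Pi>\<^sub>E i\<in>J. X i)"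
    by (rule surj_card_le[rotated])
  then show ?thesis unfolding card_PiE[OF finJ] .
qed

text \<open>The subset sum is the expansion of the product of all \<open>x i + 1\<close>, and each
  factor is at most \<open>exp (x i)\<close>.\<close>

lemma sum_prod_Pow_le_exp:
  fixes x :: "'b \<Rightarrow> real"
  assumes "finite A" "\<And>i. i \<in> A \<Longrightarrow> 0 \<le> x i"
  shows "(\<Sum>J\<in>Pow A. \<Prod>i\<in>J. x i) \<le> exp (\<Sum>i\<in>A. x i)"
proof -
  have "(\<Sum>J\<in>Pow A. \<Prod>i\<in>J. x i) = (\<Prod>i\<in>A. x i + 1)"
    using prod_add[OF assms(1), of x "\<lambda>_. 1"] by simp
  also have "\<dots> \<le> (\<Prod>i\<in>A. exp (x i))"
    using assms(2) exp_ge_add_one_self by (intro prod_mono) (simp add: add.commute)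
  finally show ?thesis by (simp add: exp_sum assms(1))
qed

text \<open>With \<open>x\<^sub>i = |X\<^sub>i| / |V|\<close>, the left-hand side is at most the product of all \<open>1 + x\<^sub>i\<close> minus \<open>1\<close>,
  hence at most \<open>e - 1\<close>.\<close>

lemma sum_card_edge_proj_le:
  assumes "kpartite_with k V H X" "finite V" "V \<noteq> {}" "\<J> \<subseteq> Pow {1..k} - {{}}"
  shows "(\<Sum>J\<in>\<J>. real (card ((\<lambda>F. edge_proj X F J) ` H)) / real (card V) ^ card J) \<le> 2"
proof -
  let ?x = "\<lambda>i. real (card (X i)) / real (card V)"
  have part: "(\<Union>i\<in>{1..k}. X i) = V" "disjoint_family_on X {1..k}"
    using assms(1) unfolding kpartite_with_def is_kpartition_def by auto
  have "card V = (\<Sum>i\<in>{1..k}. card (X i))"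
    using part assms(2) card_UN_disjoint[of "{1..k}" X] unfolding disjoint_family_on_def
    by (metis (no_types, lifting) Union_upper finite_atLeastAtMost finite_subset image_eqI)
  then have "(\<Sum>i\<in>{1..k}. real (card (X i))) = real (card V)" by simp
  moreover have "real (card V) \<noteq> 0" using assms(2,3) by simp
  ultimately have "(\<Sum>i\<in>{1..k}. ?x i) = 1" by (simp flip: sum_divide_distrib)
  then have "(\<Sum>J\<in>Pow {1..k}. \<Prod>i\<in>J. ?x i) \<le> exp 1"
    using sum_prod_Pow_le_exp[of "{1..k}" ?x] by simp
  \<comment> \<open>The empty set contributes 1, and \<open>exp 1\<close> is at most 3.\<close>
  then have "(\<Sum>J\<in>Pow {1..k} - {{}}. \<Prod>i\<in>J. ?x i) \<le> 2"
    using exp_le sum.remove[of "Pow {1..k}" "{}" "\<lambda>J. \<Prod>i\<in>J. ?x i"] by simp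
  moreover have "(\<Sum>J\<in>\<J>. \<Prod>i\<in>J. ?x i) \<le> (\<Sum>J\<in>Pow {1..k} - {{}}. \<Prod>i\<in>J. ?x i)"
    using assms(4) by (intro sum_mono2) (auto intro: prod_nonneg)
  moreover have "(\<Sum>J\<in>\<J>. real (card ((\<lambda>F. edge_proj X F J) ` H)) / real (card V) ^ card J)
      \<le> (\<Sum>J\<in>\<J>. \<Prod>i\<in>J. ?x i)"
  proof (rule sum_mono)
    fix J assume "J \<in> \<J>"
    then have "card ((\<lambda>F. edge_proj X F J) ` H) \<le> (\<Prod>i\<in>J. card (X i))"
      using card_edge_proj_le[OF assms(1,2)] assms(4) by blast
    then have "real (card ((\<lambda>F. edge_proj X F J) ` H)) \<le> (\<Prod>i\<in>J. real (card (X i)))"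
      by (metis of_nat_le_iff of_nat_prod)
    then show "real (card ((\<lambda>F. edge_proj X F J) ` H)) / real (card V) ^ card J \<le> (\<Prod>i\<in>J. ?x i)"
      by (simp add: prod_dividef divide_right_mono)
  qed
  ultimately show ?thesis by linarith
qed

section \<open>Iteration over the intersection patterns\<close>

text \<open>Induction on the number of patterns: a factor \<open>2 * real s * (1 + 2 ^ k)\<close>
  pays for each passage to a subgraph with fewer patterns, and the \<open>Suc\<close> in the
  exponent pays for the final round.\<close>

lemma ex_homogeneous_subgraph:
  assumes "finite V" "kpartite_with k V H X" "s > 0" "k \<ge> 2"
  shows "\<exists>R\<subseteq>H. real (card H) \<le> (2 * real s * (1 + 2 ^ k)) ^ Suc (card (MI k X H)) * real (card R) \<and>
    (\<forall>F\<in>R. \<forall>J\<in>MI k X R. strong s R (edge_proj X F J) \<and>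
       1 / (2 * real k) * (real (card R) / real (card V) ^ card J) \<le> real (deg R (edge_proj X F J)))"
  using assms(2)
proof (induction "card (MI k X H)" arbitrary: H rule: less_induct)
  case less
  note H = \<open>kpartite_with k V H X\<close>
  let ?A = "2 * real s * (1 + 2 ^ k)" and ?p = "\<lambda>J F. edge_proj X F J"
  have fin: "finite H" by (rule kpartite_with_finite[OF H assms(1)])
  show ?case
  proof (cases "H = {}")
    case True
    then show ?thesis by auto
  next
    case False
    then obtain F where "F \<subseteq> V" "card F = k"
      using H unfolding kpartite_with_def kgraph_on_def by blast
    then have "V \<noteq> {}" using assms(4) by auto
    define \<J> where "\<J> = MI k X H"
    have sub: "\<J> \<subseteq> Pow {1..k}" using MI_psubset[OF H] unfolding \<J>_def by blast
    have finJ: "finite \<J>" using sub finite_subset by blast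
    have cardJ: "card \<J> \<le> 2 ^ k" using card_mono[OF _ sub] by (simp add: card_Pow)
    \<comment> \<open>The empty pattern needs no threshold: its degree is the number of edges.\<close>
    define t where "t J = (if J = {} then 0
      else 1 / (2 * real k) * (real (card H) / real (card V) ^ card J))" for J :: "nat set"
    have "t J \<ge> 0" for J unfolding t_def by simp
    from cleaning[OF assms(1) H assms(3) sub, of t, OF this] obtain R G where
      R: "R \<subseteq> H" and GH: "\<forall>J\<in>\<J>. G J \<subseteq> H \<and> J \<notin> MI k X (G J)"
      and RJ: "\<forall>F\<in>R. \<forall>J\<in>\<J>. strong s R (?p J F) \<and> t J \<le> real (deg R (?p J F))"
      and le: "real (card H) \<le> real (card R) + real s * (\<Sum>J\<in>\<J>. real (card (G J)))
        + (\<Sum>J\<in>\<J>. real (card (?p J ` H)) * t J)" by (elim exE conjE) (rule that)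
    have G: "\<And>J. J \<in> \<J> \<Longrightarrow> G J \<subseteq> H" "\<And>J. J \<in> \<J> \<Longrightarrow> J \<notin> MI k X (G J)"
      using GH by auto
    have good: "\<And>F J. F \<in> R \<Longrightarrow> J \<in> \<J> \<Longrightarrow> strong s R (?p J F) \<and> t J \<le> real (deg R (?p J F))"
      using RJ by blast
    have A: "?A \<ge> 1" "?A \<ge> 2 * (1 + 2 ^ k)"
    proof -
      have "1 * (2 * (1 + 2 ^ k)) \<le> real s * (2 * (1 + 2 ^ k))"
        using assms(3) by (intro mult_right_mono) auto
      then show "?A \<ge> 2 * (1 + 2 ^ k)" by (simp add: algebra_simps)
      moreover have "(1::real) \<le> 2 * (1 + 2 ^ k)" using one_le_power[of "2::real" k] by simp
      ultimately show "?A \<ge> 1" by linarith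
    qed
    have "(\<Sum>J\<in>\<J>. real (card (?p J ` H)) * t J)
        = (\<Sum>J\<in>\<J> - {{}}. real (card (?p J ` H)) * t J)"
      by (rule sum.mono_neutral_right[OF finJ]) (auto simp: t_def)
    also have "\<dots> = (\<Sum>J\<in>\<J> - {{}}. real (card H) / (2 * real k)
        * (real (card (?p J ` H)) / real (card V) ^ card J))"
      by (rule sum.cong) (auto simp: t_def)
    also have "\<dots> = real (card H) / (2 * real k)
        * (\<Sum>J\<in>\<J> - {{}}. real (card (?p J ` H)) / real (card V) ^ card J)"
      by (rule sum_distrib_left[symmetric])
    also have "\<dots> \<le> real (card H) / (2 * real k) * 2"
      using sum_card_edge_proj_le[OF H assms(1) \<open>V \<noteq> {}\<close>, of "\<J> - {{}}"] sub
      by (intro mult_left_mono) auto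
    \<comment> \<open>The loss \<open>card H / k\<close> is at most half because \<open>k\<close> is
      at least 2.\<close>
    also have "\<dots> \<le> real (card H) / 2"
      using assms(4) mult_left_mono[of 2 "real k" "real (card H)"] by (simp add: field_simps)
    finally have half: "real (card H) / 2 \<le> real (card R) + real s * (\<Sum>J\<in>\<J>. real (card (G J)))"
      using le by linarith
    show ?thesis
    \<comment> \<open>The half in \<open>half\<close> is split into \<open>1 + 2 ^ k\<close> equal
      shares: one for \<open>R\<close> and one for each of the at most \<open>2 ^ k\<close>
      patterns.\<close>
    proof (cases "real (card H) \<le> 2 * (1 + 2 ^ k) * real (card R)")
      case True
      have "2 * (1 + 2 ^ k) * real (card R) \<le> ?A ^ Suc (card \<J>) * real (card R)"
      proof (rule mult_right_mono)
        have "?A ^ 1 \<le> ?A ^ Suc (card \<J>)" by (rule power_increasing) (use A in auto)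
        then show "2 * (1 + 2 ^ k) \<le> ?A ^ Suc (card \<J>)" using A(2) by simp
      qed simp
      then have "real (card H) \<le> ?A ^ Suc (card \<J>) * real (card R)" using True by linarith
      moreover have "strong s R (?p J F) \<and>
          1 / (2 * real k) * (real (card R) / real (card V) ^ card J) \<le> real (deg R (?p J F))"
        if F: "F \<in> R" and J: "J \<in> MI k X R" for F J
      proof
        have JJ: "J \<in> \<J>" using J MI_mono[OF R] unfolding \<J>_def by blast
        show "strong s R (?p J F)" using good[OF F JJ] by blast
        show "1 / (2 * real k) * (real (card R) / real (card V) ^ card J) \<le> real (deg R (?p J F))"
        proof (cases "J = {}")
          case True
          have "real (card R) / (2 * real k) \<le> real (card R) / 1"
            using assms(4) by (intro divide_left_mono) auto
          then show ?thesis using True by (simp add: edge_proj_def deg_eq_card)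
        next
          case False
          \<comment> \<open>The threshold was set with \<open>card H\<close>, which dominates
            \<open>card R\<close>.\<close>
          have "1 / (2 * real k) * (real (card R) / real (card V) ^ card J) \<le> t J"
            using False card_mono[OF fin R]
            by (auto simp: t_def intro!: mult_left_mono divide_right_mono)
          then show ?thesis using good[OF F JJ] by linarith
        qed
      qed
      ultimately show ?thesis using R unfolding \<J>_def by blast
    next
      case False
      have "\<exists>J\<in>\<J>. real (card H) \<le> ?A * real (card (G J))"
      proof (rule ccontr)
        assume none: "\<not> ?thesis"
        then have small: "real s * real (card (G J)) \<le> real (card H) / (2 * (1 + 2 ^ k))"
          if "J \<in> \<J>" for J
        proof -
          have "?A * real (card (G J)) \<le> real (card H)" using that none by force
          moreover have "(0::real) < 2 * (1 + 2 ^ k)" by (simp add: add_pos_pos)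
          ultimately show ?thesis by (simp add: pos_le_divide_eq mult_ac)
        qed
        have "real s * (\<Sum>J\<in>\<J>. real (card (G J))) \<le> (\<Sum>J\<in>\<J>. real (card H) / (2 * (1 + 2 ^ k)))"
          unfolding sum_distrib_left by (rule sum_mono[OF small])
        also have "\<dots> = real (card \<J>) * (real (card H) / (2 * (1 + 2 ^ k)))" by simp
        also have "\<dots> \<le> 2 ^ k * (real (card H) / (2 * (1 + 2 ^ k)))"
        proof (rule mult_right_mono)
          show "real (card \<J>) \<le> 2 ^ k" using cardJ by (metis of_nat_le_iff of_nat_numeral of_nat_power)
        qed simp
        finally have 1: "real s * (\<Sum>J\<in>\<J>. real (card (G J)))
          \<le> 2 ^ k * (real (card H) / (2 * (1 + 2 ^ k)))" .
        have pos: "(0::real) < 2 * (1 + 2 ^ k)" by (simp add: add_pos_pos)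
        \<comment> \<open>Strictness in the contradiction with \<open>half\<close> comes from the
          share of \<open>R\<close>, so it also covers an empty \<open>\<J>\<close>.\<close>
        have 2: "real (card R) < real (card H) / (2 * (1 + 2 ^ k))"
          using False pos by (simp add: pos_less_divide_eq mult.commute)
        have "real (card H) / (2 * (1 + 2 ^ k)) * (2 * (1 + 2 ^ k)) = real (card H)"
          using pos by (intro nonzero_eq_divide_eq[THEN iffD1]) auto
        moreover have "q + c * q = h / 2" if "q * (2 * (1 + c)) = h" for q c h :: real
          using that by (simp add: algebra_simps)
        ultimately have "real (card H) / (2 * (1 + 2 ^ k)) + 2 ^ k * (real (card H) / (2 * (1 + 2 ^ k)))
          = real (card H) / 2" by blast
        then show False using 1 2 half by linarith
      qed
      then obtain J where J: "J \<in> \<J>" "real (card H) \<le> ?A * real (card (G J))" by blast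
      \<comment> \<open>Passing to a subgraph creates no new pattern, and \<open>J\<close> itself is
        lost, so the induction measure drops.\<close>
      have "MI k X (G J) \<subset> \<J>" using MI_mono[OF G(1)[OF J(1)]] G(2)[OF J(1)] J(1)
        unfolding \<J>_def by blast
      then have lt: "card (MI k X (G J)) < card \<J>" using finJ psubset_card_mono by blast
      have GJ: "kpartite_with k V (G J) X" using kpartite_with_subset[OF H G(1)[OF J(1)]] .
      obtain R' where R': "R' \<subseteq> G J"
        "real (card (G J)) \<le> ?A ^ Suc (card (MI k X (G J))) * real (card R')"
        and good': "\<forall>F\<in>R'. \<forall>J\<in>MI k X R'. strong s R' (?p J F) \<and>
          1 / (2 * real k) * (real (card R') / real (card V) ^ card J) \<le> real (deg R' (?p J F))"
        using less.hyps[OF lt[unfolded \<J>_def] GJ] by blast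
      have "real (card H) \<le> ?A * (?A ^ Suc (card (MI k X (G J))) * real (card R'))"
        using J(2) mult_left_mono[OF R'(2), of ?A] A by linarith
      also have "\<dots> = ?A ^ Suc (Suc (card (MI k X (G J)))) * real (card R')" by simp
      also have "\<dots> \<le> ?A ^ Suc (card \<J>) * real (card R')"
        using lt A by (intro mult_right_mono power_increasing) auto
      finally show ?thesis using R'(1) G(1)[OF J(1)] good' unfolding \<J>_def by blast
    qed
  qed
qed

section \<open>Random colouring\<close>

text \<open>First moment: a uniformly random map to \<open>{1..k}\<close> is injective on a given edge with
  probability \<open>k! / k\<^sup>k\<close>.\<close>

lemma ex_kpartite_subgraph:
  assumes "finite V" "kgraph_on k V \<F>" "k > 0"
  shows "\<exists>H X. H \<subseteq> \<F> \<and> kpartite_with k V H X \<and> fact k / real k ^ k * real (card \<F>) \<le> real (card H)"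
proof -
  define P where "P = V \<rightarrow>\<^sub>E {1..k}"
  define S where "S f = {F \<in> \<F>. inj_on f F}" for f :: "'a \<Rightarrow> nat"
  have finF: "finite \<F>" using assms(1,2) finite_subset[of \<F> "Pow V"] unfolding kgraph_on_def by blast
  have finP: "finite P" unfolding P_def using assms(1) by (intro finite_PiE) auto
  have cardP: "card P = k ^ card V" unfolding P_def using assms(1) by (simp add: card_funcsetE)
  have Pne: "P \<noteq> {}" using cardP assms(3) by auto
  have falling: "prod ((-) k) {0..<k} = fact k"
    by (simp add: fact_prod_rev)
  have inj: "real (card {f \<in> P. inj_on f F}) = real (card P) * (fact k / real k ^ k)" if F: "F \<in> \<F>" for F
  proof -
    have FV: "F \<subseteq> V" "card F = k" using F assms(2) unfolding kgraph_on_def by auto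
    \<comment> \<open>There are \<open>k!\<close> injective colourings of \<open>F\<close>, and the
      other \<open>card V - k\<close> vertices are coloured freely.\<close>
    have "card {f \<in> P. inj_on f F} = k ^ (card V - k) * fact k"
      using card_inj_on_subset_funcset[OF assms(1) _ FV(1), of "{1..k}"] FV(2) falling
      unfolding P_def by simp
    moreover have "real k ^ card V = real k ^ (card V - k) * real k ^ k"
      using card_mono[OF assms(1) FV(1)] FV(2) by (simp flip: power_add)
    ultimately show ?thesis using assms(3) by (simp add: cardP)
  qed
  \<comment> \<open>Double counting of pairs of a colouring and an edge on which it is
    injective.\<close>
  have "(\<Sum>f\<in>P. card (S f)) = (\<Sum>F\<in>\<F>. card {f \<in> P. inj_on f F})"
    unfolding S_def using finP finF by (intro sum_multicount_gen) auto
  then have "(\<Sum>f\<in>P. real (card (S f))) = (\<Sum>F\<in>\<F>. real (card {f \<in> P. inj_on f F}))"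
    by (simp flip: of_nat_sum)
  also have "\<dots> = (\<Sum>f\<in>P. fact k / real k ^ k * real (card \<F>))"
    using inj by simp
  finally have avg: "(\<Sum>f\<in>P. real (card (S f))) = (\<Sum>f\<in>P. fact k / real k ^ k * real (card \<F>))" .
  have "\<not> (\<forall>f\<in>P. real (card (S f)) < fact k / real k ^ k * real (card \<F>))"
    using sum_strict_mono[OF finP Pne, of "\<lambda>f. real (card (S f))"
      "\<lambda>_. fact k / real k ^ k * real (card \<F>)"] unfolding avg by blast
  then obtain f where f: "f \<in> P" "fact k / real k ^ k * real (card \<F>) \<le> real (card (S f))"
    by (auto simp: not_less)
  define X where "X i = {v \<in> V. f v = i}" for i
  have fV: "f v \<in> {1..k}" if "v \<in> V" for v using f(1) that unfolding P_def by (rule PiE_mem)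
  have "card (F \<inter> X i) = 1" if F: "F \<in> S f" and i: "i \<in> {1..k}" for F i
  proof -
    have FV: "F \<subseteq> V" "card F = k" "inj_on f F"
      using F assms(2) unfolding S_def kgraph_on_def by auto
    \<comment> \<open>An injective colouring of \<open>k\<close> vertices with \<open>k\<close>
      colours uses every colour, so each colour class meets \<open>F\<close> exactly once.\<close>
    have "f ` F = {1..k}"
      using fV FV by (intro card_subset_eq) (auto simp: card_image)
    then obtain v where v: "v \<in> F" "f v = i" using i by (metis imageE)
    have "F \<inter> X i = {v}" using v FV(1,3) unfolding X_def by (auto dest: inj_onD)
    then show ?thesis by simp
  qed
  moreover have "is_kpartition k V X"
    using fV unfolding is_kpartition_def X_def disjoint_family_on_def by auto
  moreover have "kgraph_on k V (S f)" using assms(2) unfolding S_def kgraph_on_def by blast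
  ultimately have "kpartite_with k V (S f) X" unfolding kpartite_with_def by (intro conjI ballI)
  moreover have "S f \<subseteq> \<F>" unfolding S_def by blast
  ultimately show ?thesis using f(2) by (intro exI conjI)
qed

section \<open>Combining the colouring with the iteration\<close>

theorem theorem3p1:
  fixes s k n :: nat and \<F> :: "nat set set"
  assumes "s \<ge> 2" and "k \<ge> 2" and "s \<ge> 2 * k"
    and "kgraph_on k {1..n} \<F>"
  shows "\<exists>\<F>' X. \<F>' \<subseteq> \<F> \<and> kpartite_with k {1..n} \<F>' X \<and>
    real (card \<F>') \<ge> c_const k s * real (card \<F>) \<and>
    (\<forall>J\<in>MI k X \<F>'. \<forall>F\<in>\<F>'. strong s \<F>' (edge_proj X F J)) \<and>
    (\<forall>F\<in>\<F>'. \<forall>J\<in>MI k X \<F>'.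
       real (deg \<F>' (edge_proj X F J))
         \<ge> max (real s) (1 / (2 * real k) * (real (card \<F>') / real n ^ card J)))"
proof -
  let ?A = "2 * real s * (1 + 2 ^ k)"
  obtain H X where H: "H \<subseteq> \<F>" "kpartite_with k {1..n} H X"
    "fact k / real k ^ k * real (card \<F>) \<le> real (card H)"
    using ex_kpartite_subgraph[OF _ assms(4)] assms(2) by auto
  have s: "s > 0" using assms(1) by simp
  obtain R where R: "R \<subseteq> H" "real (card H) \<le> ?A ^ Suc (card (MI k X H)) * real (card R)"
    and good: "\<forall>F\<in>R. \<forall>J\<in>MI k X R. strong s R (edge_proj X F J) \<and>
      1 / (2 * real k) * (real (card R) / real n ^ card J) \<le> real (deg R (edge_proj X F J))"
    using ex_homogeneous_subgraph[OF _ H(2) s assms(2)] by auto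
  have Rp: "kpartite_with k {1..n} R X" by (rule kpartite_with_subset[OF H(2) R(1)])
  \<comment> \<open>The full set \<open>{1..k}\<close> is not a pattern, so
    \<open>Suc (card (MI k X H))\<close> is at most \<open>2 ^ k\<close>, the exponent in
    \<open>c_const\<close>.\<close>
  have "MI k X H \<subset> Pow {1..k}" using MI_psubset[OF H(2)] by blast
  then have "card (MI k X H) < 2 ^ k"
    using psubset_card_mono[of "Pow {1..k}" "MI k X H"] by (simp add: card_Pow)
  moreover have A: "?A \<ge> 1"
  proof -
    have "1 * 1 \<le> (2 * real s) * (1 + 2 ^ k)" using assms(1) by (intro mult_mono) auto
    then show ?thesis by simp
  qed
  ultimately have "?A ^ Suc (card (MI k X H)) * real (card R) \<le> ?A ^ (2 ^ k) * real (card R)"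
    by (intro mult_right_mono power_increasing) auto
  then have "fact k / real k ^ k * real (card \<F>) \<le> ?A ^ (2 ^ k) * real (card R)"
    using H(3) R(2) by linarith
  moreover have "?A ^ (2 ^ k) > 0" using A by (intro zero_less_power) linarith
  ultimately have "fact k / real k ^ k * real (card \<F>) / ?A ^ (2 ^ k) \<le> real (card R)"
    by (subst pos_divide_le_eq) (simp_all only: mult.commute[of "real (card R)"])
  then have size: "c_const k s * real (card \<F>) \<le> real (card R)"
    unfolding c_const_def by (simp only: divide_divide_eq_left times_divide_eq_left)
  have "real s \<le> real (deg R (edge_proj X F J))" if F: "F \<in> R" and J: "J \<in> MI k X R" for F J
  proof -
    \<comment> \<open>The vertex of \<open>F\<close> in a part not indexed by \<open>J\<close> shows
      that the projection is a proper subset of \<open>F\<close>, as \<open>strong_deg_ge\<close>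
      requires.\<close>
    obtain i where i: "i \<in> {1..k}" "i \<notin> J" using MI_psubset[OF Rp J] by blast
    obtain v where v: "v \<in> F \<inter> X i" using kpartite_with_meets[OF Rp F i(1)] .
    have disj: "disjoint_family_on X {1..k}"
      using Rp unfolding kpartite_with_def is_kpartition_def by blast
    have "v \<notin> X j" if "j \<in> J" for j
    proof -
      have "j \<in> {1..k}" "j \<noteq> i" using that i(2) MI_psubset[OF Rp J] by auto
      then show ?thesis using disjoint_family_onD[OF disj i(1), of j] v by blast
    qed
    then have "v \<notin> edge_proj X F J" unfolding edge_proj_def by blast
    then have "edge_proj X F J \<subset> F" using v unfolding edge_proj_def by blast
    then show ?thesis
      using strong_deg_ge[OF kpartite_with_finite[OF Rp] F _ s] good F J by auto
  qed
  then have "\<forall>F\<in>R. \<forall>J\<in>MI k X R. max (real s) (1 / (2 * real k) * (real (card R) / real n ^ card J))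
      \<le> real (deg R (edge_proj X F J))"
    using good by (intro ballI max.boundedI) blast+
  moreover have "\<forall>J\<in>MI k X R. \<forall>F\<in>R. strong s R (edge_proj X F J)" using good by blast
  moreover have "R \<subseteq> \<F>" using R(1) H(1) by (rule subset_trans)
  ultimately show ?thesis using Rp size by blast
qed

end
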